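(* Let $m$ be a positive integer. The Hankel determinant of pseudo-factorials $$H_m^{(0)}:=\det\left(\alpha_{i+j}\right)_{0\le i,j\le m-1}$$ admits the closed form $$H_m^{(0)}=\prod_{j=1}^{m-1}a_j^{m-j}=\begin{cases}\displaystyle(-1)^{m/2}\,3^{m^2/4}\left(\prod_{k=1}^{m-1}k!\right)^2 & (m\text{ even}),\\[2mm] \displaystyle(-1)^{(m-1)/2}\,3^{(m^2-1)/4}\left(\prod_{k=1}^{m-1}k!\right)^2 & (m\text{ odd}),\end{cases}$$ where $a_j=-j^2\left(2-(-1)^j\right)$.
   Context: The pseudo-factorials $(\alpha_n)_{n\ge 0}$ are the integers defined by $\alpha_0=1$ and $\alpha_{n+1}=(-1)^{n+1}\sum_{k=0}^n\binom{n}{k}\alpha_k\alpha_{n-k}$ for $n\ge 0$. Empty products equal $1$. *)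

theory Defs
  imports Jordan_Normal_Form.Determinant
begin

fun pseudo_factorial :: "nat \<Rightarrow> int" where
  "pseudo_factorial 0 = 1"
| "pseudo_factorial (Suc n) =
     (-1) ^ (n + 1) * (\<Sum>k = 0..n. of_nat (n choose k) * pseudo_factorial k * pseudo_factorial (n - k))"

text \<open>For a sequence \<open>\<alpha>\<close> of integers, \<open>hankel_det \<alpha> m\<close> is the determinant of the \<open>m\<close> by \<open>m\<close> matrix
  with entry \<open>\<alpha> (i + j)\<close> in row \<open>i\<close> and column \<open>j\<close>, both counted from zero.\<close>

definition hankel_det :: "(nat \<Rightarrow> int) \<Rightarrow> nat \<Rightarrow> int" where
  "hankel_det \<alpha> m = det (mat m m (\<lambda>(i, j). \<alpha> (i + j)))"

definition jacobi_coeff :: "nat \<Rightarrow> int" where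
  "jacobi_coeff j = - (int j ^ 2 * (2 - (-1) ^ j))"

end

theory Submission
  imports Defs "HOL-Computational_Algebra.Formal_Power_Series"
begin

text \<open>The determinant is computed from a factorisation \<open>H = L D L\<^sup>T\<close>, with \<open>L\<close> unit lower
  triangular and \<open>D\<close> diagonal, that comes from the Jacobi continued fraction of the sequence.

  Let \<open>L n k\<close> be the weighted number of lattice paths of \<open>n\<close> steps from height \<open>0\<close> to height \<open>k\<close>,
  where a level step at height \<open>k\<close> weighs \<open>b k\<close>, a step down from height \<open>k\<close> weighs \<open>c k\<close> and a
  step up weighs \<open>1\<close>. Cutting a path of \<open>i + j\<close> steps that returns to \<open>0\<close> after its first \<open>i\<close>
  steps and reversing the second part gives \<open>L (i + j) 0 = (\<Sum>k. L i k * D k * L j k)\<close> with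
  \<open>D k = c 1 * \<dots> * c k\<close>: reversal turns the \<open>k\<close> surplus up steps into down steps. Hence the
  Hankel determinant of \<open>L n 0\<close> is a product of the \<open>D k\<close>
  (\<open>motzkin_sum_factorisation\<close>, \<open>hankel_det_motzkin_sum\<close>).

  It remains to see that the pseudo-factorials are the numbers \<open>L n 0\<close> for \<open>c = jacobi_coeff\<close> and a
  suitable \<open>b\<close>. Their exponential generating function \<open>f\<close> and its reflection \<open>g x = f (- x)\<close> satisfy
  \<open>f' = - g\<^sup>2\<close> and \<open>g' = f\<^sup>2\<close>, so \<open>f\<^sup>3 + g\<^sup>3\<close> is constant, equal to \<open>2\<close>: they parametrise a Fermat
  cubic. The recurrence for \<open>L\<close> says that the generating functions \<open>\<phi> k\<close> of its columns satisfy
  \<open>\<phi> k' = \<phi> (k - 1) + b k * \<phi> k + c (k + 1) * \<phi> (k + 1)\<close>. This system is solved explicitly by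
  \<open>\<phi> (2 j) \<propto> f (1 - f g)\<^sup>j\<close> and \<open>\<phi> (2 j + 1) \<propto> (g\<^sup>2 - f) (1 - f g)\<^sup>j\<close>; after differentiation, each
  of its equations is a polynomial consequence of the cubic relation
  (\<open>fps_deriv_pf_column_even\<close>, \<open>fps_deriv_pf_column_odd\<close>). Since \<open>\<phi> 0 = f\<close>, column \<open>0\<close> of \<open>L\<close>
  consists of the pseudo-factorials (\<open>pseudo_factorial_eq_motzkin_sum\<close>).\<close>

section \<open>Hankel determinants from tridiagonal recurrences\<close>

text \<open>Weighted Motzkin paths of \<open>n\<close> steps from height \<open>0\<close> to height \<open>k\<close>: \<open>b\<close> weighs the level steps
  and \<open>c\<close> the down steps, each at its starting height.\<close>

fun motzkin_sum :: "(nat \<Rightarrow> 'a) \<Rightarrow> (nat \<Rightarrow> 'a) \<Rightarrow> nat \<Rightarrow> nat \<Rightarrow> 'a :: comm_ring_1" where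
  "motzkin_sum b c 0 k = (if k = 0 then 1 else 0)"
| "motzkin_sum b c (Suc n) k = (if k = 0 then 0 else motzkin_sum b c n (k - 1))
     + b k * motzkin_sum b c n k + c (Suc k) * motzkin_sum b c n (Suc k)"

lemma motzkin_sum_above_diagonal: "n < k \<Longrightarrow> motzkin_sum b c n k = 0"
  by (induction n arbitrary: k) auto

lemma motzkin_sum_diagonal: "motzkin_sum b c n n = 1"
  by (induction n) (auto simp: motzkin_sum_above_diagonal)

text \<open>Multiplication by \<open>D\<close> makes the tridiagonal matrix of the recurrence symmetric. Thus moving one
  step from \<open>i\<close> to \<open>j\<close> changes the pairing of rows \<open>i\<close> and \<open>j\<close> only by the boundary term of the
  truncation at \<open>N\<close>, as in the Christoffel-Darboux formula for orthogonal polynomials.\<close>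

lemma motzkin_sum_Christoffel_Darboux:
  fixes b c :: "nat \<Rightarrow> 'a :: comm_ring_1"
  defines "L \<equiv> motzkin_sum b c" and "D \<equiv> \<lambda>k. \<Prod>j = 1..k. c j"
  shows "(\<Sum>k\<le>N. D k * (L (Suc i) k * L j k - L i k * L (Suc j) k))
           = D (Suc N) * (L i (Suc N) * L j N - L i N * L j (Suc N))"
  by (induction N) (simp_all add: L_def D_def algebra_simps)

text \<open>Both products in the boundary term contain an entry of row \<open>i\<close> in column \<open>N\<close> or \<open>Suc N\<close>, so
  the term vanishes as long as \<open>i < N\<close>, however large \<open>j\<close> is. This allows all \<open>i\<close> steps to be moved
  to the other row, leaving row \<open>0\<close>, a unit vector. The bound \<open>i \<le> N\<close> is exactly what the truncated
  matrix product provides.\<close>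

lemma motzkin_sum_factorisation:
  fixes b c :: "nat \<Rightarrow> 'a :: comm_ring_1"
  defines "L \<equiv> motzkin_sum b c" and "D \<equiv> \<lambda>k. \<Prod>j = 1..k. c j"
  assumes "i \<le> N"
  shows "(\<Sum>k\<le>N. D k * (L i k * L j k)) = L (i + j) 0"
  using assms(3)
proof (induction i arbitrary: j)
  case 0
  have "(\<Sum>k\<le>N. D k * (L 0 k * L j k)) = (\<Sum>k\<le>N. if k = 0 then D k * L j k else 0)"
    by (rule sum.cong) (auto simp: L_def)
  then show ?case
    by (simp add: D_def)
next
  case (Suc i)
  have "L i (Suc N) = 0" "L i N = 0"
    using Suc.prems by (auto simp: L_def motzkin_sum_above_diagonal)
  then have "(\<Sum>k\<le>N. D k * (L (Suc i) k * L j k - L i k * L (Suc j) k)) = 0"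
    using motzkin_sum_Christoffel_Darboux[of c b i j N] by (simp add: L_def D_def)
  then have "(\<Sum>k\<le>N. D k * (L (Suc i) k * L j k)) = (\<Sum>k\<le>N. D k * (L i k * L (Suc j) k))"
    by (simp add: right_diff_distrib sum_subtractf)
  with Suc show ?case
    by simp
qed

theorem hankel_det_motzkin_sum:
  "hankel_det (\<lambda>n. motzkin_sum b c n 0) m = (\<Prod>i<m. \<Prod>j = 1..i. c j)"
proof (cases m)
  case 0
  then show ?thesis
    by (simp add: hankel_det_def)
next
  case (Suc N)
  define D where "D k = (\<Prod>j = 1..k. c j)" for k
  define L where "L = motzkin_sum b c"
  define A where "A = mat m m (\<lambda>(i, k). L i k)"
  define B where "B = mat m m (\<lambda>(k, j). D k * L j k)"
  have carrier: "A \<in> carrier_mat m m" "B \<in> carrier_mat m m"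
    by (simp_all add: A_def B_def)
  have "mat m m (\<lambda>(i, j). L (i + j) 0) = A * B"
  proof (rule eq_matI)
    fix i j assume "i < dim_row (A * B)" "j < dim_col (A * B)"
    then have ij: "i < m" "j < m"
      by (auto simp: A_def B_def)
    have "(A * B) $$ (i, j) = (\<Sum>k = 0..<m. L i k * (D k * L j k))"
      using ij by (simp add: A_def B_def scalar_prod_def)
    also have "\<dots> = (\<Sum>k\<le>N. D k * (L i k * L j k))"
      using Suc by (intro sum.cong) (auto simp: mult_ac)
    also have "\<dots> = L (i + j) 0"
      using motzkin_sum_factorisation[of i N c b j] ij Suc by (simp add: L_def D_def)
    finally show "mat m m (\<lambda>(i, j). L (i + j) 0) $$ (i, j) = (A * B) $$ (i, j)"
      using ij by simp
  qed (simp_all add: A_def B_def)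
  moreover have "det A = 1"
  proof -
    have "det A = prod_list (diag_mat A)"
      by (rule det_lower_triangular[OF _ carrier(1)])
        (auto simp: A_def L_def motzkin_sum_above_diagonal)
    also have "diag_mat A = map (\<lambda>_. 1) [0..<m]"
      by (auto simp: diag_mat_def A_def L_def motzkin_sum_diagonal)
    finally show ?thesis
      by (simp add: map_replicate_const)
  qed
  moreover have "det B = (\<Prod>i<m. D i)"
  proof -
    have "upper_triangular B"
      by (auto simp: B_def L_def motzkin_sum_above_diagonal)
    then have "det B = prod_list (diag_mat B)"
      by (rule det_upper_triangular[OF _ carrier(2)])
    also have "diag_mat B = map D [0..<m]"
      by (auto simp: diag_mat_def B_def L_def motzkin_sum_diagonal)
    finally show ?thesis
      by (simp add: prod.list_conv_set_nth atLeast0LessThan)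
  qed
  ultimately show ?thesis
    using det_mult[OF carrier] by (simp add: hankel_det_def L_def D_def)
qed

no_notation vec_index (infixl "$" 100)
unbundle fps_syntax

section \<open>The differential system of the pseudo-factorials\<close>

definition pf_egf :: "rat fps" where
  "pf_egf = Abs_fps (\<lambda>n. of_int (pseudo_factorial n) / fact n)"

definition pf_egf_reflected :: "rat fps" where
  "pf_egf_reflected = Abs_fps (\<lambda>n. (-1) ^ n * of_int (pseudo_factorial n) / fact n)"

lemma pf_egf_nth_0: "pf_egf $ 0 = 1" "pf_egf_reflected $ 0 = 1"
  by (simp_all add: pf_egf_def pf_egf_reflected_def)

text \<open>The binomial convolution in the definition of the pseudo-factorials is a Cauchy product of
  exponential generating functions; its alternating sign is absorbed by the reflection.\<close>

lemma of_int_pseudo_factorial_Suc: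
  "of_int (pseudo_factorial (Suc n)) / fact n = (- 1) ^ Suc n * (pf_egf ^ 2) $ n"
proof -
  have "(\<Sum>k = 0..n. of_nat (n choose k) * of_int (pseudo_factorial k) * of_int (pseudo_factorial (n - k))) / fact n
        = (\<Sum>k = 0..n. pf_egf $ k * pf_egf $ (n - k))"
    unfolding sum_divide_distrib
    by (rule sum.cong) (auto simp: pf_egf_def binomial_fact)
  then show ?thesis
    by (simp add: power2_eq_square fps_mult_nth flip: times_divide_eq_right)
qed

lemma pf_egf_reflected_power2_nth: "(pf_egf_reflected ^ 2) $ n = (-1) ^ n * (pf_egf ^ 2) $ n"
proof -
  have "(-1 :: rat) ^ k * (-1) ^ (n - k) = (-1) ^ n" if "k \<le> n" for k
    using that by (simp flip: power_add)
  then show ?thesis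
    unfolding power2_eq_square fps_mult_nth sum_distrib_left
    by (intro sum.cong) (auto simp: pf_egf_def pf_egf_reflected_def)
qed

lemma fps_deriv_pf_egf: "fps_deriv pf_egf = - (pf_egf_reflected ^ 2)"
proof (rule fps_ext)
  fix n
  have "fps_deriv pf_egf $ n = of_int (pseudo_factorial (Suc n)) / fact n"
    by (simp add: pf_egf_def divide_simps del: pseudo_factorial.simps)
  then show "fps_deriv pf_egf $ n = (- (pf_egf_reflected ^ 2)) $ n"
    by (simp add: of_int_pseudo_factorial_Suc pf_egf_reflected_power2_nth del: pseudo_factorial.simps)
qed

lemma fps_deriv_pf_egf_reflected: "fps_deriv pf_egf_reflected = pf_egf ^ 2"
proof (rule fps_ext)
  fix n
  have "fps_deriv pf_egf_reflected $ n = (-1) ^ Suc n * (of_int (pseudo_factorial (Suc n)) / fact n)"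
    by (simp add: pf_egf_reflected_def divide_simps del: pseudo_factorial.simps)
  then show "fps_deriv pf_egf_reflected $ n = (pf_egf ^ 2) $ n"
    by (simp add: of_int_pseudo_factorial_Suc del: pseudo_factorial.simps)
qed

text \<open>The first integral of the system \<open>f' = - g\<^sup>2\<close>, \<open>g' = f\<^sup>2\<close>; it is the only relation between the
  two series that the computation of the columns uses.\<close>

lemma pf_egf_cubic: "pf_egf ^ 3 + pf_egf_reflected ^ 3 = 2"
proof -
  have "fps_deriv (pf_egf ^ 3 + pf_egf_reflected ^ 3) = 0"
    by (simp add: power3_eq_cube fps_deriv_pf_egf fps_deriv_pf_egf_reflected algebra_simps power2_eq_square)
  then have "pf_egf ^ 3 + pf_egf_reflected ^ 3 = fps_const ((pf_egf ^ 3 + pf_egf_reflected ^ 3) $ 0)"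
    by (simp only: fps_deriv_eq_0_iff)
  then show ?thesis
    by (simp add: pf_egf_nth_0 fps_nth_power_0 fps_numeral_fps_const)
qed

lemma fps_deriv_one_minus_pf_egf_product:
  "fps_deriv (1 - pf_egf * pf_egf_reflected) = pf_egf_reflected ^ 3 - pf_egf ^ 3"
  by (simp add: fps_deriv_pf_egf fps_deriv_pf_egf_reflected power2_eq_square power3_eq_cube)

text \<open>The column generating functions form two interleaved geometric sequences. Writing \<open>f\<close> and
  \<open>g\<close> for the two series, \<open>f\<close> itself is column \<open>0\<close>, and solving \<open>f' = - f - 3 \<phi>\<^sub>1\<close> for
  column \<open>1\<close> gives a multiple of \<open>g\<^sup>2 - f\<close>; one more step gives a multiple of
  \<open>f (1 - f g)\<close>, and from there on \<open>1 - f g\<close> raises the height by two. The denominators are left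
  to \<open>pf_scale\<close> below, so that the differential system has integer coefficients.\<close>

definition pf_column :: "nat \<Rightarrow> rat fps" where
  "pf_column k = (if even k then pf_egf else pf_egf_reflected ^ 2 - pf_egf)
     * (1 - pf_egf * pf_egf_reflected) ^ (k div 2)"

lemma fps_deriv_pf_column_even:
  "fps_deriv (pf_column (2 * j)) = of_nat (2 * j) * pf_column (2 * j - 1)
     - of_nat (2 * j + 1) * pf_column (2 * j) - of_nat (2 * j + 1) * pf_column (2 * j + 1)"
proof (cases j)
  case 0
  then show ?thesis
    by (simp add: pf_column_def fps_deriv_pf_egf)
next
  case (Suc i)
  define f g where "f = pf_egf" and "g = pf_egf_reflected"
  define u where "u = 1 - f * g"
  have d: "fps_deriv f = - (g ^ 2)" "fps_deriv g = f ^ 2" and c: "f ^ 3 + g ^ 3 = 2"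
    by (simp_all add: f_def g_def fps_deriv_pf_egf fps_deriv_pf_egf_reflected pf_egf_cubic)
  have du: "fps_deriv u = g ^ 3 - f ^ 3"
    unfolding u_def f_def g_def by (rule fps_deriv_one_minus_pf_egf_product)
  have col: "pf_column (2 * j) = f * u ^ j" "pf_column (2 * j - 1) = (g ^ 2 - f) * u ^ i"
    "pf_column (2 * j + 1) = (g ^ 2 - f) * u ^ j"
    using Suc by (simp_all add: pf_column_def f_def g_def u_def)
  define J :: "rat fps" where "J = of_nat j"
  have dpow: "fps_deriv (u ^ j) = J * (g ^ 3 - f ^ 3) * u ^ i"
    unfolding fps_deriv_power J_def fps_of_nat du by (simp add: Suc)
  have "fps_deriv (pf_column (2 * j)) = (- (g ^ 2) * u + J * f * (g ^ 3 - f ^ 3)) * u ^ i"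
    unfolding col fps_deriv_mult d dpow using Suc by (simp add: algebra_simps)
  \<comment> \<open>The last summand, a multiple of the cubic relation, vanishes.\<close>
  also have "- (g ^ 2) * u + J * f * (g ^ 3 - f ^ 3)
     = 2 * J * (g ^ 2 - f) - (2 * J + 1) * f * u - (2 * J + 1) * (g ^ 2 - f) * u
       - J * f * (f ^ 3 + g ^ 3 - 2)"
    by (simp add: u_def power2_eq_square power3_eq_cube algebra_simps)
  finally show ?thesis
    unfolding col using Suc by (simp add: c J_def algebra_simps)
qed

lemma fps_deriv_pf_column_odd:
  "fps_deriv (pf_column (2 * j + 1)) = 3 * of_nat (2 * j + 1) * pf_column (2 * j)
     + of_nat (2 * j + 1) * pf_column (2 * j + 1) - of_nat (2 * j + 2) * pf_column (2 * j + 2)"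
proof -
  define f g where "f = pf_egf" and "g = pf_egf_reflected"
  define u where "u = 1 - f * g"
  have d: "fps_deriv f = - (g ^ 2)" "fps_deriv g = f ^ 2" and c: "f ^ 3 + g ^ 3 = 2"
    by (simp_all add: f_def g_def fps_deriv_pf_egf fps_deriv_pf_egf_reflected pf_egf_cubic)
  have du: "fps_deriv u = g ^ 3 - f ^ 3"
    unfolding u_def f_def g_def by (rule fps_deriv_one_minus_pf_egf_product)
  have dh: "fps_deriv (g ^ 2 - f) = 2 * g * f ^ 2 + g ^ 2"
    by (simp add: d power2_eq_square algebra_simps)
  have col: "pf_column (2 * j) = f * u ^ j" "pf_column (2 * j + 1) = (g ^ 2 - f) * u ^ j"
    "pf_column (2 * j + 2) = f * u ^ (j + 1)"
    by (simp_all add: pf_column_def f_def g_def u_def)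
  define J :: "rat fps" where "J = of_nat j"
  show ?thesis
  proof (cases j)
    case 0
    then show ?thesis
      unfolding col by (simp add: dh del: fps_deriv_sub) (simp add: u_def algebra_simps power2_eq_square)
  next
    case (Suc i)
    have dpow: "fps_deriv (u ^ j) = J * (g ^ 3 - f ^ 3) * u ^ i"
      unfolding fps_deriv_power J_def fps_of_nat du by (simp add: Suc)
    have "fps_deriv (pf_column (2 * j + 1))
      = ((2 * g * f ^ 2 + g ^ 2) * u + J * (g ^ 2 - f) * (g ^ 3 - f ^ 3)) * u ^ i"
      unfolding col fps_deriv_mult dh dpow using Suc by (simp add: algebra_simps)
    \<comment> \<open>Again the last summand vanishes by the cubic relation.\<close>
    also have "(2 * g * f ^ 2 + g ^ 2) * u + J * (g ^ 2 - f) * (g ^ 3 - f ^ 3)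
       = 3 * (2 * J + 1) * f * u + (2 * J + 1) * (g ^ 2 - f) * u - (2 * J + 2) * f * u ^ 2
         + J * (f + g ^ 2) * (f ^ 3 + g ^ 3 - 2)"
      by (simp add: u_def power2_eq_square power3_eq_cube algebra_simps)
    finally show ?thesis
      unfolding col using Suc by (simp add: c J_def algebra_simps power2_eq_square)
  qed
qed

section \<open>The continued fraction of the pseudo-factorials\<close>

text \<open>The level weights \<open>-1, 1, -3, 3, -5, 5, \<dots>\<close> are read off from the differential system.\<close>

definition pf_diagonal :: "nat \<Rightarrow> int" where
  "pf_diagonal k = (if even k then - int (k + 1) else int k)"

text \<open>The factor by which \<open>pf_column k\<close> exceeds the generating function of column \<open>k\<close>, whose leading
  term is \<open>x\<^sup>k / k!\<close>: both \<open>g\<^sup>2 - f\<close> and \<open>1 - f g\<close> start with a coefficient \<open>3\<close>.\<close>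

definition pf_scale :: "nat \<Rightarrow> int" where
  "pf_scale k = 3 ^ ((k + 1) div 2) * fact k"

lemma pf_scale_Suc: "pf_scale (Suc k) = (if even k then 3 else 1) * int (Suc k) * pf_scale k"
  by (auto simp: pf_scale_def elim!: evenE oddE)

text \<open>The square and the factor \<open>3\<close> in \<open>jacobi_coeff\<close> arise here: passing to the next scale uses up one
  factor \<open>Suc k\<close>, and the factor \<open>3\<close> if there is one, and the differential system supplies the other
  factor \<open>Suc k\<close>.\<close>

lemma jacobi_coeff_Suc_pf_scale:
  "jacobi_coeff (Suc k) * pf_scale k = - int (Suc k) * pf_scale (Suc k)"
  by (simp add: pf_scale_Suc jacobi_coeff_def power2_eq_square algebra_simps)

lemma fps_deriv_pf_column:
  "fps_deriv (pf_column k) = of_nat k * (if even k then 1 else 3) * pf_column (k - 1)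
     + of_int (pf_diagonal k) * pf_column k - of_nat (k + 1) * pf_column (k + 1)"
proof (cases "even k")
  case True
  then obtain j where "k = 2 * j" by (elim evenE)
  then show ?thesis
    using fps_deriv_pf_column_even[of j] by (simp add: pf_diagonal_def algebra_simps)
next
  case False
  then obtain j where "k = 2 * j + 1" by (elim oddE)
  then show ?thesis
    using fps_deriv_pf_column_odd[of j] by (simp add: pf_diagonal_def algebra_simps)
qed

lemma pf_column_nth_0: "pf_column k $ 0 = (if k = 0 then 1 else 0)"
proof -
  have "k = 0 \<or> odd k \<or> k div 2 > 0"
    by presburger
  then show ?thesis
    by (auto simp: pf_column_def pf_egf_nth_0 fps_nth_power_0 power_0_left)
qed

text \<open>Taking coefficients in the differential system gives the recurrence of \<open>motzkin_sum\<close>, up to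
  scaling, and the values at \<open>0\<close> give its initial row.\<close>

lemma pf_column_nth:
  "of_int (motzkin_sum pf_diagonal jacobi_coeff n k * pf_scale k) = fact n * pf_column k $ n"
proof (induction n arbitrary: k)
  case 0
  show ?case
    by (simp add: pf_column_nth_0 pf_scale_def)
next
  case (Suc n)
  let ?L = "motzkin_sum pf_diagonal jacobi_coeff"
  have 1: "(if k = 0 then 0 else ?L n (k - 1)) * pf_scale k
      = int k * (if even k then 1 else 3) * (?L n (k - 1) * pf_scale (k - 1))"
    by (cases k) (auto simp: pf_scale_Suc)
  have "?L (Suc n) k * pf_scale k = (if k = 0 then 0 else ?L n (k - 1)) * pf_scale k
      + pf_diagonal k * (?L n k * pf_scale k) + ?L n (Suc k) * (jacobi_coeff (Suc k) * pf_scale k)"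
    by (simp add: algebra_simps)
  also have "\<dots> = int k * (if even k then 1 else 3) * (?L n (k - 1) * pf_scale (k - 1))
      + pf_diagonal k * (?L n k * pf_scale k) - int (Suc k) * (?L n (Suc k) * pf_scale (Suc k))"
    unfolding 1 jacobi_coeff_Suc_pf_scale by (simp add: algebra_simps)
  finally have "of_int (?L (Suc n) k * pf_scale k)
      = of_nat k * (if even k then 1 else 3) * (fact n * pf_column (k - 1) $ n)
      + of_int (pf_diagonal k) * (fact n * pf_column k $ n)
      - of_nat (Suc k) * (fact n * pf_column (Suc k) $ n)"
    by (simp only: of_int_add of_int_diff of_int_mult Suc.IH[unfolded of_int_mult]) simp
  also have "\<dots> = fact n * fps_deriv (pf_column k) $ n"
    unfolding fps_deriv_pf_column
    by (simp add: algebra_simps fps_numeral_fps_const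
        flip: fps_of_nat fps_of_int)
  also have "\<dots> = fact (Suc n) * pf_column k $ Suc n"
    by (simp add: algebra_simps)
  finally show ?case .
qed

lemma pseudo_factorial_eq_motzkin_sum:
  "pseudo_factorial n = motzkin_sum pf_diagonal jacobi_coeff n 0"
proof -
  have "of_int (motzkin_sum pf_diagonal jacobi_coeff n 0) = (of_int (pseudo_factorial n) :: rat)"
    using pf_column_nth[of n 0] by (simp add: pf_scale_def pf_column_def pf_egf_def)
  then show ?thesis
    by simp
qed

section \<open>The closed form\<close>

lemma prod_jacobi_coeff:
  "(\<Prod>j = 1..i. jacobi_coeff j) = (-1) ^ i * 3 ^ ((i + 1) div 2) * fact i ^ 2"
proof (induction i)
  case (Suc i)
  have "jacobi_coeff (Suc i) = (if even i then - 3 else - 1) * int (Suc i) ^ 2"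
    by (simp add: jacobi_coeff_def)
  with Suc show ?case
    by (auto simp: power_mult_distrib elim!: evenE oddE)
qed simp

lemma prod_power_eq_prod_prod:
  fixes a :: "nat \<Rightarrow> 'a :: comm_monoid_mult"
  shows "(\<Prod>j = 1..m - 1. a j ^ (m - j)) = (\<Prod>i<m. \<Prod>j = 1..i. a j)"
proof (induction m)
  case (Suc m)
  have "(\<Prod>j = 1..Suc m - 1. a j ^ (Suc m - j)) = (\<Prod>j = 1..m. a j ^ (m - j) * a j)"
    by (intro prod.cong) (auto simp: Suc_diff_le mult.commute)
  also have "\<dots> = (\<Prod>j = 1..m. a j ^ (m - j)) * (\<Prod>j = 1..m. a j)"
    by (rule prod.distrib)
  also have "(\<Prod>j = 1..m. a j ^ (m - j)) = (\<Prod>j = 1..m - 1. a j ^ (m - j))"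
    by (cases m) simp_all
  finally show ?case
    unfolding Suc.IH by simp
qed simp

text \<open>Integer division lets one formula serve both parities of \<open>m\<close>: the exponents are
  \<open>\<lfloor>m\<^sup>2 / 4\<rfloor> = \<Sum>i<m. \<lceil>i / 2\<rceil>\<close> for \<open>3\<close>, and \<open>m (m - 1) / 2\<close> for the sign, which has the parity of
  \<open>\<lfloor>m / 2\<rfloor>\<close>.\<close>

lemma prod_prod_jacobi_coeff:
  "(\<Prod>i<m. \<Prod>j = 1..i. jacobi_coeff j)
     = (-1) ^ (m div 2) * 3 ^ (m ^ 2 div 4) * (\<Prod>k<m. fact k) ^ 2"
proof (induction m)
  case (Suc m)
  have three: "Suc m ^ 2 div 4 = m ^ 2 div 4 + (m + 1) div 2"
    by (cases "even m") (auto elim!: evenE oddE simp: power2_eq_square algebra_simps)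
  have sign: "(-1 :: int) ^ (Suc m div 2) = (-1) ^ (m div 2) * (-1) ^ m"
    by (cases "even m") (auto elim!: evenE oddE)
  show ?case
    unfolding prod.lessThan_Suc Suc.IH three sign unfolding prod_jacobi_coeff
    by (simp add: power_add power_mult_distrib)
qed simp

theorem corollary1:
  fixes m :: nat
  assumes "m \<ge> 1"
  shows "hankel_det pseudo_factorial m = (\<Prod>j = 1..m - 1. jacobi_coeff j ^ (m - j))
    \<and> (\<Prod>j = 1..m - 1. jacobi_coeff j ^ (m - j)) =
        (if even m
         then (-1) ^ (m div 2) * 3 ^ (m ^ 2 div 4) * (\<Prod>k = 1..m - 1. fact k) ^ 2
         else (-1) ^ ((m - 1) div 2) * 3 ^ ((m ^ 2 - 1) div 4) * (\<Prod>k = 1..m - 1. fact k) ^ 2)"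
proof
  show "hankel_det pseudo_factorial m = (\<Prod>j = 1..m - 1. jacobi_coeff j ^ (m - j))"
    unfolding prod_power_eq_prod_prod pseudo_factorial_eq_motzkin_sum[abs_def]
    by (rule hankel_det_motzkin_sum)
next
  have "{..<m} = insert 0 {1..m - 1}"
    using assms by auto
  then have fact: "(\<Prod>k<m. fact k :: int) = (\<Prod>k = 1..m - 1. fact k)"
    by simp
  have "(m - 1) div 2 = m div 2" "(m ^ 2 - 1) div 4 = m ^ 2 div 4" if "odd m"
    using that by (auto elim!: oddE simp: power2_eq_square algebra_simps)
  then show "(\<Prod>j = 1..m - 1. jacobi_coeff j ^ (m - j)) =
        (if even m
         then (-1) ^ (m div 2) * 3 ^ (m ^ 2 div 4) * (\<Prod>k = 1..m - 1. fact k) ^ 2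
         else (-1) ^ ((m - 1) div 2) * 3 ^ ((m ^ 2 - 1) div 4) * (\<Prod>k = 1..m - 1. fact k) ^ 2)"
    unfolding prod_power_eq_prod_prod prod_prod_jacobi_coeff fact by simp
qed

end
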